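(* Let $m\le n$, let $A\in\mathbb{R}^{n\times m}$ have full rank, and let $f:\mathbb{R}^n\times\mathbb{R}^m\to\mathbb{R}$, $f(x,y)=x^TAy$. Let $\sigma_{\max}(A)$ and $\sigma_{\min}(A)$ be the largest and smallest singular values of $A$, and $\kappa:=\sigma_{\max}^2(A)/\sigma_{\min}^2(A)$. Let $\rho>0$ and $0<\eta\le \frac{2\rho}{\sigma_{\max}(A)}$. Then the DGDA iterates with parameters $\eta,\rho$ converge linearly to a saddle point: there is a constant $\beta>0$, independent of $k$ and of the initial point $(x_0,\hat x_0,y_0,\hat y_0)\in\mathbb{R}^n\times\mathbb{R}^n\times\mathbb{R}^m\times\mathbb{R}^m$, such that for every initial point there is a saddle point $(x^*,y^* )$ of $f$ for which, for all $k\ge 0$, $$V_k\le \beta\left(1-2\rho+2\rho^2+(1-\rho)\sqrt{4\rho^2-\eta^2\sigma_{\min}^2(A)}\right)^k V_0 .$$ In particular, for $\rho=1/2$ and $\eta=1/\sigma_{\max}(A)$, there is a constant $\beta>0$, independent of $k$ and of the initial point, such that for every initial point there is a saddle point $(x^*,y^* )$ of $f$ for which, for all $k\ge 0$, $$V_k\le \beta\left(1-\frac{1}{4\kappa}\right)^k V_0 .$$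
   Context: A saddle point of $f$ is a point $(x^*,y^* )$ with $f(x^*,y)\le f(x^*,y^* )\le f(x,y^* )$ for all $x\in\mathbb{R}^n$, $y\in\mathbb{R}^m$. Dissipative gradient descent ascent (DGDA) with step size $\eta>0$ and damping parameter $\rho$, applied to a differentiable $f$, is the iteration $$x_{k+1}=x_k-\eta\nabla_xf(x_k,y_k)-\rho(x_k-\hat x_k),\qquad \hat x_{k+1}=\hat x_k-\rho(\hat x_k-x_k),$$ $$y_{k+1}=y_k+\eta\nabla_yf(x_k,y_k)-\rho(y_k-\hat y_k),\qquad \hat y_{k+1}=\hat y_k-\rho(\hat y_k-y_k).$$ Given a saddle point $(x^*,y^* )$, put $\hat x^*:=x^*$, $\hat y^*:=y^*$ and $$V_k:=\|x_k-x^*\|^2+\|y_k-y^*\|^2+\|\hat x_k-\hat x^*\|^2+\|\hat y_k-\hat y^*\|^2$$ (Euclidean norms). Since $A$ has full rank, $\sigma_{\min}(A)>0$ denotes the smallest of its $m$ singular values.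
   Formalization: The first claim is proved under the added conditions ρ<1 and ησ_min(A)<2ρ; without them it fails: for A=(1), ρ=1/2, η=1 a Jordan block makes V_k grow like k²2^{-k}; for ρ>1 the bound fails, and for ρ=1 the rate is 1, so there is no linear convergence. *)

theory Defs
  imports "HOL-Analysis.Analysis"
begin

definition saddle_point :: "('a \<Rightarrow> 'b \<Rightarrow> real) \<Rightarrow> 'a \<Rightarrow> 'b \<Rightarrow> bool" where
  "saddle_point f xs ys \<longleftrightarrow> (\<forall>x y. f xs y \<le> f xs ys \<and> f xs ys \<le> f x ys)"

text \<open>Only meaningful where \<open>f\<close> is differentiable.\<close>

definition gradient :: "('a::real_inner \<Rightarrow> real) \<Rightarrow> 'a \<Rightarrow> 'a" where
  "gradient f x = (THE D. GDERIV f x :> D)"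

text \<open>States are quadruples \<open>(x, xh, y, yh)\<close>, where \<open>xh\<close> and \<open>yh\<close> are the hatted variables.
  All four components are updated simultaneously from the old state.\<close>

fun dgda_step ::
  "('a::real_inner \<Rightarrow> 'b::real_inner \<Rightarrow> real) \<Rightarrow> real \<Rightarrow> real \<Rightarrow> 'a \<times> 'a \<times> 'b \<times> 'b \<Rightarrow> 'a \<times> 'a \<times> 'b \<times> 'b"
where
  "dgda_step f \<eta> \<rho> (x, xh, y, yh) =
     (x - \<eta> *\<^sub>R gradient (\<lambda>u. f u y) x - \<rho> *\<^sub>R (x - xh),
      xh - \<rho> *\<^sub>R (xh - x),
      y + \<eta> *\<^sub>R gradient (\<lambda>v. f x v) y - \<rho> *\<^sub>R (y - yh),
      yh - \<rho> *\<^sub>R (yh - y))"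

definition dgda ::
  "('a::real_inner \<Rightarrow> 'b::real_inner \<Rightarrow> real) \<Rightarrow> real \<Rightarrow> real \<Rightarrow> 'a \<times> 'a \<times> 'b \<times> 'b \<Rightarrow> nat \<Rightarrow> 'a \<times> 'a \<times> 'b \<times> 'b"
where
  "dgda f \<eta> \<rho> s0 k = (dgda_step f \<eta> \<rho> ^^ k) s0"

fun lyapunov :: "'a::real_inner \<Rightarrow> 'b::real_inner \<Rightarrow> 'a \<times> 'a \<times> 'b \<times> 'b \<Rightarrow> real" where
  "lyapunov xs ys (x, xh, y, yh) =
     (norm (x - xs))\<^sup>2 + (norm (y - ys))\<^sup>2 + (norm (xh - xs))\<^sup>2 + (norm (yh - ys))\<^sup>2"

text \<open>The matrix \<open>A\<close> below has \<open>CARD('n)\<close> rows and \<open>CARD('m)\<close> columns. For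
  \<open>CARD('m) \<le> CARD('n)\<close>, its \<open>CARD('m)\<close> singular values are the square roots of the eigenvalues
  of \<open>transpose A ** A\<close>; the set forgets their multiplicities. It is finite and nonempty, so
  \<open>Max\<close> and \<open>Min\<close> are meaningful.\<close>

definition eigenvalue :: "real^'k^'k \<Rightarrow> real \<Rightarrow> bool" where
  "eigenvalue M c \<longleftrightarrow> (\<exists>v. v \<noteq> 0 \<and> M *v v = c *\<^sub>R v)"

definition singular_values :: "real^'m^'n \<Rightarrow> real set" where
  "singular_values A = {sqrt c | c. eigenvalue (transpose A ** A) c}"

definition sigma_max :: "real^'m^'n \<Rightarrow> real" where
  "sigma_max A = Max (singular_values A)"

definition sigma_min :: "real^'m^'n \<Rightarrow> real" where
  "sigma_min A = Min (singular_values A)"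

definition kappa :: "real^'m^'n \<Rightarrow> real" where
  "kappa A = (sigma_max A)\<^sup>2 / (sigma_min A)\<^sup>2"

definition bilinear_fun :: "real^'m^'n \<Rightarrow> real^'n \<Rightarrow> real^'m \<Rightarrow> real" where
  "bilinear_fun A x y = x \<bullet> (A *v y)"

definition dgda_rate :: "real^'m^'n \<Rightarrow> real \<Rightarrow> real \<Rightarrow> real" where
  "dgda_rate A \<eta> \<rho> =
     1 - 2 * \<rho> + 2 * \<rho>\<^sup>2 + (1 - \<rho>) * sqrt (4 * \<rho>\<^sup>2 - \<eta>\<^sup>2 * (sigma_min A)\<^sup>2)"

text \<open>For a singular value \<open>\<sigma>\<close> of \<open>A\<close> and \<open>t = \<eta> * \<sigma> \<le> 2 * \<rho>\<close>, the iteration on the corresponding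
  pair of singular directions is, in the complex variables \<open>z = x + i y\<close> and \<open>zh = xh + i yh\<close>,
  multiplication by the matrix with rows \<open>(1 - \<rho> + i t, \<rho>)\<close> and \<open>(\<rho>, 1 - \<rho>)\<close>. Its eigenvalues
  have squared moduli \<open>1 - 2 \<rho> + 2 \<rho>\<^sup>2 \<plusminus> (1 - \<rho>) sqrt (4 \<rho>\<^sup>2 - t\<^sup>2)\<close>. Hence \<open>dgda_rate\<close> comes from
  \<open>\<sigma>_min\<close> and the sign \<open>+\<close>. It is not a valid rate on all of \<open>0 < \<rho>\<close>,
  \<open>0 < \<eta> \<le> 2 \<rho> / \<sigma>_max\<close>:

  For \<open>\<rho> > 1\<close> the sign \<open>-\<close> gives the larger modulus, which exceeds 1 if \<open>t < 2 \<rho>\<close>, and the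
  iterates diverge; for \<open>\<rho> = 1\<close> all moduli, and \<open>dgda_rate\<close>, are 1, so there is no linear
  convergence.

  For \<open>\<eta> \<sigma>_min = 2 \<rho>\<close>, which forces \<open>\<sigma>_min = \<sigma>_max\<close> and \<open>\<eta> = 2 \<rho> / \<sigma>_max\<close>, the two
  eigenvalues coincide and the matrix is not diagonalizable. Then \<open>V\<^sub>k\<close> grows like
  \<open>k\<^sup>2 * dgda_rate ^ k\<close>, and no constant \<open>\<beta>\<close> exists. An example is \<open>m = n = 1\<close>, \<open>A = 1\<close>,
  \<open>\<rho> = 1/2\<close>, \<open>\<eta> = 1\<close>.

  Statements about \<open>dgda_rate\<close> therefore need \<open>\<rho> < 1\<close> and \<open>\<eta> * sigma_min A < 2 * \<rho>\<close>.\<close>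

text \<open>The constant \<open>\<beta>\<close> precedes the initial point \<open>s0\<close>, the saddle point precedes \<open>k\<close>.\<close>

definition dgda_converges_linearly ::
  "('a::real_inner \<Rightarrow> 'b::real_inner \<Rightarrow> real) \<Rightarrow> real \<Rightarrow> real \<Rightarrow> real \<Rightarrow> bool"
where
  "dgda_converges_linearly f \<eta> \<rho> r \<longleftrightarrow>
     0 \<le> r \<and> r < 1 \<and>
     (\<exists>\<beta>>0. \<forall>s0. \<exists>xs ys. saddle_point f xs ys \<and>
        (\<forall>k. lyapunov xs ys (dgda f \<eta> \<rho> s0 k) \<le> \<beta> * r ^ k * lyapunov xs ys s0))"

end

theory Submission
  imports Defs
begin

text \<open>
  Let \<open>b\<close> range over an orthonormal eigenbasis of \<open>A\<^sup>T A\<close> and put \<open>u\<^sub>b = A b / \<bar>A b\<bar>\<close>. In the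
  coordinates \<open>z = \<langle>x, u\<^sub>b\<rangle> + i \<langle>y, b\<rangle>\<close>, \<open>w = \<langle>xh, u\<^sub>b\<rangle> + i \<langle>yh, b\<rangle>\<close> the iteration splits into the maps
  \<open>(z, w) \<mapsto> ((1 - \<rho> + i t) z + \<rho> w, \<rho> z + (1 - \<rho>) w)\<close> with \<open>t = \<eta> \<bar>A b\<bar>\<close>. For \<open>t < 2 \<rho>\<close> the form
  \<open>\<bar>z\<bar>\<^sup>2 + \<bar>w\<bar>\<^sup>2 + (t / \<rho>) Im (cnj z * w)\<close> is positive definite and makes the two eigenvectors orthogonal,
  so it contracts by exactly the larger squared modulus of the eigenvalues. For \<open>t = 2 \<rho>\<close> there is
  a Jordan block, but then the rate demanded is strictly larger than its squared spectral radius.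
  On the orthogonal complement of the range of \<open>A\<close> the pair \<open>(x, xh)\<close> tends to its mean, which
  determines the saddle point, and the difference shrinks by \<open>1 - 2 \<rho>\<close> in every step.
\<close>

subsection \<open>Orthonormal eigenbases of symmetric maps\<close>

text \<open>First-order optimality: for small \<open>e\<close> the linear term decides the sign. It
  is applied below to perturbations of a maximizer.\<close>

lemma quadratic_nonneg_imp_linear_coeff_zero:
  fixes a b :: real
  assumes "\<And>e. 0 \<le> 2 * e * b + e\<^sup>2 * a"
  shows "b = 0"
proof (rule ccontr)
  assume "b \<noteq> 0"
  \<comment> \<open>Any \<open>k > 0\<close> with \<open>a < 2 * k\<close> works: at
    \<open>e = - b / k\<close> the quadratic is then negative.\<close>
  define k where "k = \<bar>a\<bar> + 1"
  have k: "k > 0" "a < 2 * k" by (auto simp: k_def)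
  have "2 * (- b / k) * b + (- b / k)\<^sup>2 * a = (b / k)\<^sup>2 * (a - 2 * k)"
    using k by (simp add: field_simps power2_eq_square)
  moreover have "(b / k)\<^sup>2 * (a - 2 * k) < 0"
    using \<open>b \<noteq> 0\<close> k by (intro mult_pos_neg) auto
  ultimately show False
    using assms[of "- b / k"] by simp
qed

text \<open>A maximizer \<open>v\<close> of the Rayleigh quotient on the unit sphere of
  \<open>S\<close> works: stationarity makes \<open>f v - c *\<^sub>R v\<close> orthogonal to
  \<open>S\<close>, and invariance puts it into \<open>S\<close>, so it vanishes.\<close>

lemma symmetric_linear_has_eigenvector:
  fixes f :: "'a::euclidean_space \<Rightarrow> 'a"
  assumes f: "linear f" and sym: "\<And>x y. f x \<bullet> y = x \<bullet> f y"
    and S: "subspace S" and inv: "f ` S \<subseteq> S" and nz: "\<not> S \<subseteq> {0}"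
  obtains v c where "v \<in> S" "norm v = 1" "f v = c *\<^sub>R v"
proof -
  interpret linear f by (rule f)
  define K where "K = S \<inter> sphere 0 1"
  have "compact K"
    unfolding K_def using S by (intro closed_Int_compact closed_subspace compact_sphere)
  moreover have "K \<noteq> {}"
  proof -
    obtain w where "w \<in> S" "w \<noteq> 0" using nz by auto
    then have "w /\<^sub>R norm w \<in> K" using S by (simp add: K_def subspace_scale)
    then show ?thesis by auto
  qed
  moreover have "continuous_on K (\<lambda>x. f x \<bullet> x)"
    by (intro continuous_intros linear_continuous_on f linear_conv_bounded_linear[THEN iffD1])
  ultimately obtain v where v: "v \<in> K" and max: "\<And>x. x \<in> K \<Longrightarrow> f x \<bullet> x \<le> f v \<bullet> v"
    using continuous_attains_sup[of K "\<lambda>x. f x \<bullet> x"] by blast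
  define c where "c = f v \<bullet> v"
  have vS: "v \<in> S" and nv: "norm v = 1" using v by (auto simp: K_def)
  have vv: "v \<bullet> v = 1" using nv by (simp add: norm_eq_1)
  have rayleigh: "f x \<bullet> x \<le> c * (x \<bullet> x)" if "x \<in> S" for x
  proof (cases "x = 0")
    case False
    then have "x /\<^sub>R norm x \<in> K" using that S by (simp add: K_def subspace_scale)
    from max[OF this] have "(f x \<bullet> x) / (norm x)\<^sup>2 \<le> c"
      by (simp add: c_def scale power2_eq_square divide_inverse mult_ac)
    then show ?thesis using False by (simp add: divide_le_eq power2_norm_eq_inner)
  qed (simp add: zero)
  have orth: "(f v - c *\<^sub>R v) \<bullet> w = 0" if w: "w \<in> S" for w
  proof -
    have "(c *\<^sub>R v - f v) \<bullet> w = 0"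
    \<comment> \<open>The quadratic in \<open>e\<close> is the slack of \<open>rayleigh\<close> at
      \<open>v + e *\<^sub>R w\<close>; its constant term cancels because \<open>v\<close> attains
      equality.\<close>
    proof (rule quadratic_nonneg_imp_linear_coeff_zero[where a = "c * (w \<bullet> w) - f w \<bullet> w"])
      fix e :: real
      have "v + e *\<^sub>R w \<in> S" using vS w S by (intro subspace_add subspace_scale)
      from rayleigh[OF this]
      have "(f v + e *\<^sub>R f w) \<bullet> (v + e *\<^sub>R w) \<le> c * ((v + e *\<^sub>R w) \<bullet> (v + e *\<^sub>R w))"
        unfolding add scale .
      moreover have "(f v + e *\<^sub>R f w) \<bullet> (v + e *\<^sub>R w) = c + 2 * e * (f v \<bullet> w) + e\<^sup>2 * (f w \<bullet> w)"
        using sym[of w v] by (simp add: inner_add inner_commute c_def power2_eq_square distrib_left)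
      moreover have "(v + e *\<^sub>R w) \<bullet> (v + e *\<^sub>R w) = 1 + 2 * e * (v \<bullet> w) + e\<^sup>2 * (w \<bullet> w)"
        by (simp add: inner_add inner_commute vv power2_eq_square distrib_left)
      ultimately have "c + 2 * e * (f v \<bullet> w) + e\<^sup>2 * (f w \<bullet> w) \<le> c * (1 + 2 * e * (v \<bullet> w) + e\<^sup>2 * (w \<bullet> w))"
        by (simp only:)
      then show "0 \<le> 2 * e * ((c *\<^sub>R v - f v) \<bullet> w) + e\<^sup>2 * (c * (w \<bullet> w) - f w \<bullet> w)"
        by (simp add: inner_diff_left algebra_simps)
    qed
    then show ?thesis by (simp add: inner_diff_left)
  qed
  have "f v - c *\<^sub>R v \<in> S"
    using vS inv S by (auto intro!: subspace_diff subspace_scale)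
  from orth[OF this] have "f v = c *\<^sub>R v" by simp
  with vS nv that show ?thesis by blast
qed

text \<open>Induction on the dimension: split off one unit eigenvector; by symmetry its orthogonal
  complement in \<open>S\<close> is again invariant.\<close>

lemma symmetric_linear_orthonormal_eigenbasis_subspace:
  fixes f :: "'a::euclidean_space \<Rightarrow> 'a"
  assumes f: "linear f" and sym: "\<And>x y. f x \<bullet> y = x \<bullet> f y"
    and "subspace S" and "f ` S \<subseteq> S"
  shows "\<exists>B. finite B \<and> B \<subseteq> S \<and> S \<subseteq> span B \<and> pairwise orthogonal B \<and>
             (\<forall>b\<in>B. norm b = 1 \<and> (\<exists>c. f b = c *\<^sub>R b))"
  using assms(3,4)
proof (induction "dim S" arbitrary: S rule: less_induct)
  case less
  show ?case
  proof (cases "S \<subseteq> {0}")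
    case True
    then show ?thesis by (intro exI[of _ "{}"]) auto
  next
    case False
    then obtain v c where v: "v \<in> S" "norm v = 1" "f v = c *\<^sub>R v"
      using symmetric_linear_has_eigenvector[OF f sym less.prems] by blast
    have vv: "v \<bullet> v = 1" using v by (simp add: norm_eq_1)
    define T where "T = S \<inter> {x. v \<bullet> x = 0}"
    have T: "subspace T"
      unfolding T_def using less.prems by (auto intro: subspace_inter subspace_hyperplane)
    have "v \<notin> T" using vv by (simp add: T_def)
    moreover have "T \<subseteq> S" by (simp add: T_def)
    ultimately have "T \<subset> S" using v by blast
    then have "dim T < dim S"
      using T less.prems by (intro dim_psubset) (simp add: span_eq_iff[THEN iffD2])
    moreover have "f ` T \<subseteq> T"
    proof -
      have "v \<bullet> f x = 0" if "v \<bullet> x = 0" for x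
        using sym[of v x] that v by simp
      then show ?thesis using less.prems by (auto simp: T_def)
    qed
    ultimately obtain B where B: "finite B" "B \<subseteq> T" "T \<subseteq> span B" "pairwise orthogonal B"
        "\<forall>b\<in>B. norm b = 1 \<and> (\<exists>c. f b = c *\<^sub>R b)"
      using less.hyps T by meson
    have "x \<in> span (insert v B)" if "x \<in> S" for x
    proof -
      have "x - (v \<bullet> x) *\<^sub>R v \<in> T"
        using that v vv less.prems by (auto simp: T_def inner_diff_right intro!: subspace_diff subspace_scale)
      then show ?thesis using B by (auto simp: span_insert)
    qed
    moreover have "pairwise orthogonal (insert v B)"
      using B by (auto simp: pairwise_insert T_def orthogonal_def inner_commute)
    ultimately show ?thesis
      using B v \<open>T \<subset> S\<close> by (intro exI[of _ "insert v B"]) auto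
  qed
qed

corollary symmetric_linear_orthonormal_eigenbasis:
  fixes f :: "'a::euclidean_space \<Rightarrow> 'a"
  assumes "linear f" and "\<And>x y. f x \<bullet> y = x \<bullet> f y"
  obtains B where "finite B" "span B = UNIV" "pairwise orthogonal B"
    "\<And>b. b \<in> B \<Longrightarrow> norm b = 1" "\<And>b. b \<in> B \<Longrightarrow> \<exists>c. f b = c *\<^sub>R b"
  using symmetric_linear_orthonormal_eigenbasis_subspace[OF assms, of UNIV] by auto

subsection \<open>The iteration in one singular direction\<close>

definition mode_step :: "real \<Rightarrow> real \<Rightarrow> complex \<times> complex \<Rightarrow> complex \<times> complex" where
  "mode_step t \<rho> = (\<lambda>(z, w). (Complex (1 - \<rho>) t * z + of_real \<rho> * w, of_real \<rho> * z + of_real (1 - \<rho>) * w))"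

definition energy :: "complex \<times> complex \<Rightarrow> real" where
  "energy = (\<lambda>(z, w). (cmod z)\<^sup>2 + (cmod w)\<^sup>2)"

definition mode_rate :: "real \<Rightarrow> real \<Rightarrow> real" where
  "mode_rate t \<rho> = 1 - 2 * \<rho> + 2 * \<rho>\<^sup>2 + (1 - \<rho>) * sqrt (4 * \<rho>\<^sup>2 - t\<^sup>2)"

text \<open>The smallest singular value thus gives the slowest mode. The range
  \<open>t > 2 * \<rho>\<close> is covered too, since \<open>sqrt\<close> is extended to negative
  reals as an increasing odd function.\<close>

lemma mode_rate_antimono:
  assumes "\<rho> \<le> 1" "0 \<le> s" "s \<le> t"
  shows "mode_rate t \<rho> \<le> mode_rate s \<rho>"
  unfolding mode_rate_def using assms
  by (intro add_left_mono mult_left_mono real_sqrt_le_mono diff_left_mono power_mono) auto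

lemma mode_rate_strict_antimono:
  assumes "\<rho> < 1" "0 \<le> s" "s < t"
  shows "mode_rate t \<rho> < mode_rate s \<rho>"
  unfolding mode_rate_def using assms
  by (intro add_strict_left_mono mult_strict_left_mono real_sqrt_less_mono diff_strict_left_mono
      power_strict_mono) auto

lemma mode_rate_zero: "0 \<le> \<rho> \<Longrightarrow> mode_rate 0 \<rho> = 1"
  by (simp add: mode_rate_def real_sqrt_mult) (simp add: power2_eq_square algebra_simps)

lemma mode_rate_double: "mode_rate (2 * \<rho>) \<rho> = 1 - 2 * \<rho> + 2 * \<rho>\<^sup>2"
  by (simp add: mode_rate_def power_mult_distrib)

lemma energy_nonneg: "0 \<le> energy s"
  by (cases s) (simp add: energy_def)

text \<open>The contraction is iterated in \<open>U\<close>, and the comparison with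
  \<open>V\<close> is paid for once at each end, so the constant does not depend on
  \<open>k\<close>.\<close>

lemma funpow_bound_of_lyapunov:
  fixes V U :: "'s \<Rightarrow> real"
  assumes step: "\<And>s. U (F s) \<le> r * U s" and lower: "\<And>s. V s \<le> a * U s"
    and upper: "\<And>s. U s \<le> b * V s" and nonneg: "0 \<le> a" "0 \<le> r"
  shows "V ((F ^^ k) s) \<le> (a * b) * r ^ k * V s"
proof -
  have "U ((F ^^ k) s) \<le> r ^ k * U s"
  proof (induction k)
    case (Suc k)
    have "U ((F ^^ Suc k) s) \<le> r * U ((F ^^ k) s)" using step by simp
    also have "\<dots> \<le> r * (r ^ k * U s)" using Suc nonneg by (intro mult_left_mono)
    finally show ?case by simp
  qed simp
  also have "\<dots> \<le> r ^ k * (b * V s)" using upper nonneg by (intro mult_left_mono) auto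
  finally have "a * U ((F ^^ k) s) \<le> a * (r ^ k * (b * V s))" using nonneg by (intro mult_left_mono)
  with lower[of "(F ^^ k) s"] show ?thesis by (simp add: mult_ac)
qed

lemma mode_decay_nondegenerate:
  assumes "0 < \<rho>" "\<rho> < 1" "0 \<le> t" "t < 2 * \<rho>" "mode_rate t \<rho> \<le> r"
  shows "\<exists>\<beta>>0. \<forall>s k. energy ((mode_step t \<rho> ^^ k) s) \<le> \<beta> * r ^ k * energy s"
proof -
  define \<tau> where "\<tau> = t / (2 * \<rho>)"
  have \<tau>: "0 \<le> \<tau>" "\<tau> < 1" "t = 2 * \<rho> * \<tau>" using assms by (auto simp: \<tau>_def)
  \<comment> \<open>\<open>q\<close> is \<open>Im (cnj z * w)\<close>. With \<open>\<tau> = sin \<theta>\<close>, \<open>\<sigma> = cos \<theta>\<close> the eigenvectors are \<open>(1, cis (- \<theta>))\<close> and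
    \<open>(1, - cis \<theta>)\<close>; \<open>W\<close> is the form that makes them orthogonal.\<close>
  define q where "q = (\<lambda>(z, w). Re z * Im w - Im z * Re w)"
  define W where "W s = energy s + 2 * \<tau> * q s" for s
  define \<sigma> where "\<sigma> = sqrt (1 - \<tau>\<^sup>2)"
  have \<sigma>: "0 \<le> \<sigma>" "\<sigma>\<^sup>2 = 1 - \<tau>\<^sup>2" using \<tau> by (auto simp: \<sigma>_def abs_square_le_1 power_le_one)
  have rate: "mode_rate t \<rho> = 1 - 2 * \<rho> + 2 * \<rho>\<^sup>2 + 2 * (1 - \<rho>) * \<rho> * \<sigma>"
  proof -
    have "4 * \<rho>\<^sup>2 - t\<^sup>2 = (2 * \<rho>)\<^sup>2 * (1 - \<tau>\<^sup>2)" unfolding \<tau>(3) by (simp add: algebra_simps power_mult_distrib)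
    then have "sqrt (4 * \<rho>\<^sup>2 - t\<^sup>2) = 2 * \<rho> * \<sigma>" using assms(1) by (simp add: \<sigma>_def real_sqrt_mult)
    then show ?thesis by (simp add: mode_rate_def)
  qed
  have q: "\<bar>2 * q s\<bar> \<le> energy s" for s
  proof -
    obtain a b c d where s: "s = (Complex a b, Complex c d)" by (metis complex.exhaust surj_pair)
    \<comment> \<open>These are the squared moduli of \<open>w + \<i> * z\<close> and
      \<open>w - \<i> * z\<close>, that is, \<open>energy s\<close> plus and minus
      \<open>2 * q s\<close>.\<close>
    have "0 \<le> (a + d)\<^sup>2 + (b - c)\<^sup>2" "0 \<le> (a - d)\<^sup>2 + (b + c)\<^sup>2" by auto
    moreover have "energy s = a\<^sup>2 + b\<^sup>2 + c\<^sup>2 + d\<^sup>2"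
      by (simp add: s energy_def cmod_power2)
    ultimately show ?thesis by (simp add: s q_def power2_sum power2_diff abs_le_iff)
  qed
  have q': "\<bar>2 * \<tau> * q s\<bar> \<le> \<tau> * energy s" for s
    using mult_left_mono[OF q[of s] \<tau>(1)] \<tau>(1) by (simp add: abs_mult mult_ac)
  have lower: "(1 - \<tau>) * energy s \<le> W s" for s
    using q'[of s] by (simp add: W_def algebra_simps)
  have upper: "W s \<le> 2 * energy s" for s
    using q'[of s] mult_right_mono[OF less_imp_le[OF \<tau>(2)] energy_nonneg[of s]] by (simp add: W_def)
  have "W (mode_step t \<rho> s) \<le> r * W s" for s
  proof -
    obtain a b c d where s: "s = (Complex a b, Complex c d)" by (metis complex.exhaust surj_pair)
    have W: "W s = a\<^sup>2 + b\<^sup>2 + c\<^sup>2 + d\<^sup>2 + 2 * \<tau> * (a * d - b * c)"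
      by (simp add: s W_def energy_def q_def cmod_power2)
    have "mode_step t \<rho> s = (Complex ((1 - \<rho>) * a - t * b + \<rho> * c) ((1 - \<rho>) * b + t * a + \<rho> * d),
        Complex (\<rho> * a + (1 - \<rho>) * c) (\<rho> * b + (1 - \<rho>) * d))"
      by (simp add: s mode_step_def complex_eq_iff)
    then have W': "W (mode_step t \<rho> s) = ((1 - \<rho>) * a - t * b + \<rho> * c)\<^sup>2 + ((1 - \<rho>) * b + t * a + \<rho> * d)\<^sup>2
        + (\<rho> * a + (1 - \<rho>) * c)\<^sup>2 + (\<rho> * b + (1 - \<rho>) * d)\<^sup>2
        + 2 * \<tau> * (((1 - \<rho>) * a - t * b + \<rho> * c) * (\<rho> * b + (1 - \<rho>) * d)
          - ((1 - \<rho>) * b + t * a + \<rho> * d) * (\<rho> * a + (1 - \<rho>) * c))"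
      by (simp add: W_def energy_def q_def cmod_power2)
    \<comment> \<open>The left side is the squared modulus of
      \<open>cis (- \<theta>) * z - w\<close>. It vanishes on the dominant eigenvector, where the
      contraction by \<open>mode_rate t \<rho>\<close> is an equality.\<close>
    have "(\<sigma> * a + \<tau> * b - c)\<^sup>2 + (\<sigma> * b - \<tau> * a - d)\<^sup>2
        = (\<sigma>\<^sup>2 + \<tau>\<^sup>2) * (a\<^sup>2 + b\<^sup>2) + c\<^sup>2 + d\<^sup>2 + 2 * \<tau> * (a * d - b * c) - 2 * \<sigma> * (a * c + b * d)"
      by (simp add: power2_eq_square algebra_simps)
    also have "\<sigma>\<^sup>2 + \<tau>\<^sup>2 = 1" using \<sigma>(2) by simp
    finally have "(\<sigma> * a + \<tau> * b - c)\<^sup>2 + (\<sigma> * b - \<tau> * a - d)\<^sup>2 = W s - 2 * \<sigma> * (a * c + b * d)"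
      by (simp add: W)
    \<comment> \<open>The extra factor \<open>\<sigma>\<close> produces
      \<open>\<sigma>\<^sup>2\<close>, to be replaced by \<open>1 - \<tau>\<^sup>2\<close> to match
      the next identity.\<close>
    then have "\<sigma> * ((\<sigma> * a + \<tau> * b - c)\<^sup>2 + (\<sigma> * b - \<tau> * a - d)\<^sup>2) = \<sigma> * W s - 2 * \<sigma>\<^sup>2 * (a * c + b * d)"
      by (simp add: right_diff_distrib power2_eq_square[of \<sigma>])
    moreover have "mode_rate t \<rho> * W s - W (mode_step t \<rho> s)
        = 2 * (1 - \<rho>) * \<rho> * (\<sigma> * W s - 2 * (1 - \<tau>\<^sup>2) * (a * c + b * d))"
      unfolding rate W W' unfolding \<tau>(3) by (simp add: power2_eq_square algebra_simps)
    ultimately have "mode_rate t \<rho> * W s - W (mode_step t \<rho> s)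
        = 2 * (1 - \<rho>) * \<rho> * \<sigma> * ((\<sigma> * a + \<tau> * b - c)\<^sup>2 + (\<sigma> * b - \<tau> * a - d)\<^sup>2)"
      using \<sigma>(2) by (simp add: mult.assoc)
    also have "\<dots> \<ge> 0" using assms \<sigma> by (intro mult_nonneg_nonneg add_nonneg_nonneg) auto
    finally have "W (mode_step t \<rho> s) \<le> mode_rate t \<rho> * W s" by simp
    also have "\<dots> \<le> r * W s"
    proof (rule mult_right_mono[OF assms(5)])
      show "0 \<le> W s" using lower[of s] \<tau> energy_nonneg[of s] by (smt (verit) mult_nonneg_nonneg)
    qed
    finally show ?thesis .
  qed
  moreover have "energy s \<le> 1 / (1 - \<tau>) * W s" for s
    using lower[of s] \<tau> by (simp add: field_simps)
  moreover have "0 \<le> r"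
  proof -
    have "0 \<le> (1 - \<rho>)\<^sup>2 + \<rho>\<^sup>2 + 2 * (1 - \<rho>) * \<rho> * \<sigma>" using assms \<sigma> by auto
    then show ?thesis using assms(5) rate by (simp add: power2_eq_square algebra_simps)
  qed
  ultimately have "energy ((mode_step t \<rho> ^^ k) s) \<le> (1 / (1 - \<tau>) * 2) * r ^ k * energy s" for s k
    using \<tau> by (intro funpow_bound_of_lyapunov[where U = W] upper) auto
  then show ?thesis using \<tau> by (intro exI[of _ "1 / (1 - \<tau>) * 2"]) auto
qed

text \<open>Young's inequality: a small \<open>\<delta>\<close> keeps the first coefficient near 1
  at the expense of the second.\<close>

lemma norm_add_power2_le_weighted:
  fixes x y :: "'a::real_inner"
  assumes "0 < \<delta>"
  shows "(norm (x + y))\<^sup>2 \<le> (1 + \<delta>) * (norm x)\<^sup>2 + (1 + 1 / \<delta>) * (norm y)\<^sup>2"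
proof -
  have "0 \<le> (norm (\<delta> *\<^sub>R x - y))\<^sup>2" by simp
  then have "2 * \<delta> * (x \<bullet> y) \<le> \<delta>\<^sup>2 * (norm x)\<^sup>2 + (norm y)\<^sup>2"
    by (simp only: power2_norm_eq_inner) (simp add: inner_diff inner_commute power2_eq_square algebra_simps)
  then have "2 * (x \<bullet> y) \<le> \<delta> * (norm x)\<^sup>2 + (norm y)\<^sup>2 / \<delta>"
    using assms by (simp add: field_simps power2_eq_square)
  then show ?thesis
    by (simp add: power2_norm_eq_inner inner_add inner_commute algebra_simps)
qed

lemma mode_decay_degenerate:
  assumes "0 < \<rho>" "\<rho> < 1" "mode_rate (2 * \<rho>) \<rho> < r"
  shows "\<exists>\<beta>>0. \<forall>s k. energy ((mode_step (2 * \<rho>) \<rho> ^^ k) s) \<le> \<beta> * r ^ k * energy s"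
proof -
  \<comment> \<open>The double eigenvalue of \<open>mode_step (2 * \<rho>) \<rho>\<close>.\<close>
  define \<mu> where "\<mu> = Complex (1 - \<rho>) \<rho>"
  define r0 where "r0 = (cmod \<mu>)\<^sup>2"
  have r0: "0 < r0" "r0 < r"
  proof -
    have "r0 = (1 - \<rho>)\<^sup>2 + \<rho>\<^sup>2" by (simp add: r0_def \<mu>_def cmod_power2)
    moreover have "mode_rate (2 * \<rho>) \<rho> = r0"
      unfolding mode_rate_double calculation by (simp add: power2_eq_square algebra_simps)
    ultimately show "0 < r0" "r0 < r" using assms by (auto intro: add_nonneg_pos)
  qed
  \<comment> \<open>The whole gap between \<open>r0\<close> and \<open>r\<close> is spent on Young's
    inequality for \<open>z\<close>.\<close>
  define \<delta> where "\<delta> = r / r0 - 1"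
  have \<delta>: "0 < \<delta>" "(1 + \<delta>) * r0 = r" using r0 by (auto simp: \<delta>_def)
  \<comment> \<open>The solution of the balance equation for the coefficient of the squared modulus
    of \<open>d\<close>: coupling plus own decay equals \<open>K * r\<close>.\<close>
  define K where "K = (1 + 1 / \<delta>) * \<rho>\<^sup>2 / (r - r0)"
  have K: "0 < K" "(1 + 1 / \<delta>) * \<rho>\<^sup>2 + K * r0 = K * r"
    using r0 \<delta> assms by (auto simp: K_def field_simps intro!: add_pos_pos)
  \<comment> \<open>\<open>d\<close> is a left eigenvector of the Jordan block: \<open>d' = \<mu> d\<close> and \<open>z' = \<mu> z + \<rho> d\<close>. A large
    multiple of \<open>\<bar>d\<bar>\<^sup>2\<close> absorbs the coupling.\<close>
  define d where "d = (\<lambda>(z, w). w + \<i> * z)"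
  define U where "U s = (cmod (fst s))\<^sup>2 + K * (cmod (d s))\<^sup>2" for s
  have "U (mode_step (2 * \<rho>) \<rho> s) \<le> r * U s" for s
  proof -
    obtain z w where s: "s = (z, w)" by fastforce
    have "fst (mode_step (2 * \<rho>) \<rho> s) = \<mu> * z + of_real \<rho> * d s"
      by (simp add: s mode_step_def d_def \<mu>_def complex_eq_iff algebra_simps)
    then have "(cmod (fst (mode_step (2 * \<rho>) \<rho> s)))\<^sup>2
        \<le> (1 + \<delta>) * (cmod (\<mu> * z))\<^sup>2 + (1 + 1 / \<delta>) * (cmod (of_real \<rho> * d s))\<^sup>2"
      using norm_add_power2_le_weighted[OF \<delta>(1)] by simp
    also have "\<dots> = r * (cmod z)\<^sup>2 + (1 + 1 / \<delta>) * \<rho>\<^sup>2 * (cmod (d s))\<^sup>2"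
      unfolding \<delta>(2)[symmetric] r0_def by (simp add: norm_mult power_mult_distrib)
    finally have 1: "(cmod (fst (mode_step (2 * \<rho>) \<rho> s)))\<^sup>2 \<le> \<dots>" .
    have "d (mode_step (2 * \<rho>) \<rho> s) = \<mu> * d s"
      by (simp add: s mode_step_def d_def \<mu>_def complex_eq_iff algebra_simps)
    then have 2: "(cmod (d (mode_step (2 * \<rho>) \<rho> s)))\<^sup>2 = r0 * (cmod (d s))\<^sup>2"
      by (simp add: norm_mult power_mult_distrib r0_def)
    have "U (mode_step (2 * \<rho>) \<rho> s)
        \<le> r * (cmod z)\<^sup>2 + ((1 + 1 / \<delta>) * \<rho>\<^sup>2 + K * r0) * (cmod (d s))\<^sup>2"
      unfolding U_def 2 using 1 by (simp add: algebra_simps)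
    also have "\<dots> = r * U s" unfolding K by (simp add: U_def s algebra_simps)
    finally show ?thesis .
  qed
  moreover have "energy s \<le> (3 + 2 / K) * U s" for s
  proof -
    obtain z w where s: "s = (z, w)" by fastforce
    have "(cmod w)\<^sup>2 \<le> 2 * (cmod (d s))\<^sup>2 + 2 * (cmod z)\<^sup>2"
      using norm_add_power2_le_weighted[of 1 "d s" "- (\<i> * z)"] by (simp add: d_def s norm_mult)
    moreover have "(3 + 2 / K) * U s = 3 * (cmod z)\<^sup>2 + 2 * (cmod (d s))\<^sup>2 + (2 / K * (cmod z)\<^sup>2 + 3 * K * (cmod (d s))\<^sup>2)"
      using K by (simp add: U_def s field_simps)
    moreover have "0 \<le> 2 / K * (cmod z)\<^sup>2 + 3 * K * (cmod (d s))\<^sup>2" using K by simp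
    ultimately show ?thesis by (simp add: energy_def s)
  qed
  moreover have "U s \<le> (1 + 2 * K) * energy s" for s
  proof -
    obtain z w where s: "s = (z, w)" by fastforce
    have "(cmod (d s))\<^sup>2 \<le> 2 * energy s"
      using norm_add_power2_le_weighted[of 1 w "\<i> * z"] by (simp add: d_def s energy_def norm_mult)
    then have "K * (cmod (d s))\<^sup>2 \<le> K * (2 * energy s)" using K by (intro mult_left_mono) auto
    moreover have "(cmod (fst s))\<^sup>2 \<le> energy s" by (simp add: s energy_def)
    ultimately show ?thesis by (simp add: U_def algebra_simps)
  qed
  ultimately have "energy ((mode_step (2 * \<rho>) \<rho> ^^ k) s) \<le> ((3 + 2 / K) * (1 + 2 * K)) * r ^ k * energy s" for s k
    using K r0 by (intro funpow_bound_of_lyapunov[where U = U]) auto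
  moreover have "0 < (3 + 2 / K) * (1 + 2 * K)" using K by (auto intro!: mult_pos_pos add_pos_pos)
  ultimately show ?thesis by blast
qed

subsection \<open>Decoupling along the singular directions\<close>

lemma gradient_eqI:
  assumes "GDERIV f x :> D"
  shows "gradient f x = D"
  unfolding gradient_def
proof (rule the_equality)
  show "GDERIV f x :> D" by (rule assms)
next
  fix D'
  assume "GDERIV f x :> D'"
  then have "(\<lambda>h. h \<bullet> D') = (\<lambda>h. h \<bullet> D)"
    using assms unfolding gderiv_def by (rule has_derivative_unique)
  then show "D' = D"
    by (metis vector_eq_ldot)
qed

lemma gradient_inner_left: "gradient (\<lambda>u. u \<bullet> c) x = c"
  by (rule gradient_eqI) (auto simp: gderiv_def intro!: derivative_eq_intros)

lemma dgda_step_bilinear_fun: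
  "dgda_step (bilinear_fun A) \<eta> \<rho> (x, xh, y, yh) =
     (x - \<eta> *\<^sub>R (A *v y) - \<rho> *\<^sub>R (x - xh), xh - \<rho> *\<^sub>R (xh - x),
      y + \<eta> *\<^sub>R (x v* A) - \<rho> *\<^sub>R (y - yh), yh - \<rho> *\<^sub>R (yh - y))"
proof -
  have "(\<lambda>v. bilinear_fun A x v) = (\<lambda>v. v \<bullet> (x v* A))"
    by (simp add: bilinear_fun_def dot_lmul_matrix[symmetric] inner_commute)
  then show ?thesis
    by (simp add: bilinear_fun_def[of A _ y] gradient_inner_left)
qed

text \<open>The function vanishes on both slices through such a point, so both inequalities are
  equalities.\<close>

lemma saddle_point_bilinear_fun:
  assumes "xs v* A = 0"
  shows "saddle_point (bilinear_fun A) xs 0"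
  using assms by (simp add: saddle_point_def bilinear_fun_def dot_lmul_matrix[symmetric])

lemma scaleR_reflect:
  fixes x :: "'v::real_vector"
  shows "x - c *\<^sub>R (x - - x) = (1 - 2 * c) *\<^sub>R x"
proof -
  have "x - - x = 2 *\<^sub>R x" by (simp add: scaleR_2)
  then show ?thesis by (simp only:) (simp add: scaleR_diff_left mult.commute)
qed

text \<open>A singular value decomposition of \<open>A\<close> with full column rank:
  \<open>B\<close> holds the right singular vectors, and \<open>norm (A *v b)\<close> is the
  singular value of \<open>b\<close>. Multiplicities are kept, unlike in
  \<open>singular_values\<close>.\<close>

locale singular_system =
  fixes A :: "real^'m^'n" and B :: "(real^'m) set"
  assumes finite_B: "finite B" and span_B: "span B = UNIV"
    and orthogonal_B: "pairwise orthogonal B" and norm_B: "b \<in> B \<Longrightarrow> norm b = 1"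
    and gram_eigen: "b \<in> B \<Longrightarrow> (A *v b) v* A = (norm (A *v b))\<^sup>2 *\<^sub>R b"
    and nonzero: "b \<in> B \<Longrightarrow> A *v b \<noteq> 0"
begin

definition left_vec :: "real^'m \<Rightarrow> real^'n" where
  "left_vec b = (A *v b) /\<^sub>R norm (A *v b)"

lemma inner_B: "b \<in> B \<Longrightarrow> c \<in> B \<Longrightarrow> b \<bullet> c = (if b = c then 1 else 0)"
  using orthogonal_B norm_B[of b] by (auto simp: pairwise_def orthogonal_def norm_eq_1)

lemma expand: "(\<Sum>b\<in>B. (y \<bullet> b) *\<^sub>R b) = y"
  using orthonormal_basis_expand[OF orthogonal_B norm_B _ finite_B] span_B by simp

text \<open>With \<open>inner_adjoint_image\<close> this decouples the iteration: \<open>A\<close>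
  links the coordinate along \<open>b\<close> only to the one along
  \<open>left_vec b\<close>.\<close>

lemma inner_image_left_vec:
  assumes "b \<in> B"
  shows "(A *v y) \<bullet> left_vec b = norm (A *v b) * (y \<bullet> b)"
proof -
  have "(A *v y) \<bullet> (A *v b) = (norm (A *v b))\<^sup>2 * (y \<bullet> b)"
    using gram_eigen[OF assms] by (metis dot_lmul_matrix inner_commute inner_scaleR_left)
  then show ?thesis
    using nonzero[OF assms] by (simp add: left_vec_def power2_eq_square)
qed

lemma inner_adjoint_image:
  "b \<in> B \<Longrightarrow> (x v* A) \<bullet> b = norm (A *v b) * (x \<bullet> left_vec b)"
  using nonzero by (simp add: dot_lmul_matrix left_vec_def)

lemma inner_left_vec:
  assumes "b \<in> B" "c \<in> B"
  shows "left_vec b \<bullet> left_vec c = (if b = c then 1 else 0)"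
proof -
  have "left_vec b \<bullet> left_vec c = ((A *v b) \<bullet> left_vec c) / norm (A *v b)"
    by (simp add: left_vec_def[of b] divide_inverse mult.commute)
  then show ?thesis
    using assms nonzero by (simp add: inner_image_left_vec inner_B)
qed

text \<open>The orthogonal projection onto the complement of the range of \<open>A\<close>.\<close>

definition residual :: "real^'n \<Rightarrow> real^'n" where
  "residual x = x - (\<Sum>b\<in>B. (x \<bullet> left_vec b) *\<^sub>R left_vec b)"

lemma linear_residual: "linear residual"
  by (rule linearI)
    (simp_all add: residual_def inner_add_left scaleR_add_left sum.distrib scaleR_sum_right
      scaleR_diff_right)

lemma residual_image: "residual (A *v y) = 0"
proof -
  have "A *v y = (\<Sum>b\<in>B. (y \<bullet> b) *\<^sub>R (A *v b))"
    by (subst (1) expand[of y, symmetric])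
      (simp add: linear_sum[OF matrix_vector_mul_linear] matrix_vector_mult_scaleR)
  also have "\<dots> = (\<Sum>b\<in>B. ((A *v y) \<bullet> left_vec b) *\<^sub>R left_vec b)"
    by (rule sum.cong, simp, simp only: inner_image_left_vec, simp add: left_vec_def nonzero)
  finally show ?thesis by (simp add: residual_def)
qed

lemma inner_residual: "b \<in> B \<Longrightarrow> residual x \<bullet> left_vec b = 0"
  using finite_B
  by (simp add: residual_def inner_diff_left inner_sum_left inner_left_vec if_distrib sum.delta
      cong: if_cong)

text \<open>Every coordinate along \<open>B\<close> vanishes by orthogonality to the left singular
  vectors. Residuals therefore supply saddle points.\<close>

lemma residual_left_null: "residual x v* A = 0"
proof -
  have "residual x v* A = (\<Sum>b\<in>B. ((residual x v* A) \<bullet> b) *\<^sub>R b)"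
    by (rule expand[symmetric])
  also have "\<dots> = 0"
    by (rule sum.neutral) (simp add: inner_adjoint_image inner_residual)
  finally show ?thesis .
qed

lemma residual_idem: "residual (residual x) = residual x"
  by (simp add: residual_def[of "residual x"] inner_residual)

lemma norm_residual: "(norm x)\<^sup>2 = (norm (residual x))\<^sup>2 + (\<Sum>b\<in>B. (x \<bullet> left_vec b)\<^sup>2)"
proof -
  define p where "p = (\<Sum>b\<in>B. (x \<bullet> left_vec b) *\<^sub>R left_vec b)"
  have "residual x \<bullet> p = 0"
    by (simp add: p_def inner_sum_right inner_residual)
  moreover have "p \<bullet> p = (\<Sum>b\<in>B. (x \<bullet> left_vec b)\<^sup>2)"
  proof -
    have "p \<bullet> left_vec b = x \<bullet> left_vec b" if "b \<in> B" for b
      using inner_residual[OF that, of x] by (simp add: residual_def p_def inner_diff_left)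
    then have "(\<Sum>b\<in>B. (x \<bullet> left_vec b) * (p \<bullet> left_vec b)) = (\<Sum>b\<in>B. (x \<bullet> left_vec b)\<^sup>2)"
      by (simp add: power2_eq_square)
    moreover have "p \<bullet> p = (\<Sum>b\<in>B. (x \<bullet> left_vec b) * (p \<bullet> left_vec b))"
      by (subst (2) p_def) (simp add: inner_sum_right)
    ultimately show ?thesis by simp
  qed
  moreover have "x = residual x + p" by (simp add: residual_def p_def)
  ultimately show ?thesis
    by (metis norm_add_Pythagorean orthogonal_def power2_norm_eq_inner)
qed

lemma norm_expand: "(norm y)\<^sup>2 = (\<Sum>b\<in>B. (y \<bullet> b)\<^sup>2)"
proof -
  have "y \<bullet> y = (\<Sum>b\<in>B. (y \<bullet> b) *\<^sub>R b) \<bullet> y" by (simp only: expand)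
  also have "\<dots> = (\<Sum>b\<in>B. (y \<bullet> b)\<^sup>2)"
    by (simp add: inner_sum_left inner_sum_right power2_eq_square inner_commute)
  finally show ?thesis by (simp add: power2_norm_eq_inner)
qed

section \<open>The iteration in singular coordinates\<close>

fun mode :: "real^'m \<Rightarrow> (real^'n) \<times> (real^'n) \<times> (real^'m) \<times> (real^'m) \<Rightarrow> complex \<times> complex" where
  "mode b (x, xh, y, yh) = (Complex (x \<bullet> left_vec b) (y \<bullet> b), Complex (xh \<bullet> left_vec b) (yh \<bullet> b))"

text \<open>Descent in \<open>x\<close> and ascent in \<open>y\<close> couple the two coordinates
  with opposite signs, which is multiplication by \<open>\<i> * t\<close> on the complex number they
  form.\<close>

lemma mode_dgda_step:
  assumes "b \<in> B"
  shows "mode b (dgda_step (bilinear_fun A) \<eta> \<rho> s) = mode_step (\<eta> * norm (A *v b)) \<rho> (mode b s)"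
proof -
  obtain x xh y yh where s: "s = (x, xh, y, yh)" by (metis surj_pair)
  show ?thesis
    unfolding s dgda_step_bilinear_fun
    by (simp add: mode_step_def complex_eq_iff inner_diff_left inner_add_left
        inner_image_left_vec[OF assms] inner_adjoint_image[OF assms] algebra_simps)
qed

lemma mode_dgda:
  "b \<in> B \<Longrightarrow> mode b (dgda (bilinear_fun A) \<eta> \<rho> s k) = (mode_step (\<eta> * norm (A *v b)) \<rho> ^^ k) (mode b s)"
  by (induction k) (simp_all add: dgda_def mode_dgda_step)

text \<open>The part of \<open>lyapunov\<close> that the modes miss. Only \<open>x\<close> and
  \<open>xh\<close> contribute, because \<open>B\<close> spans the whole \<open>y\<close>
  space.\<close>

fun residual_energy :: "real^'n \<Rightarrow> (real^'n) \<times> (real^'n) \<times> (real^'m) \<times> (real^'m) \<Rightarrow> real" where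
  "residual_energy xs (x, xh, y, yh) = (norm (residual (x - xs)))\<^sup>2 + (norm (residual (xh - xs)))\<^sup>2"

text \<open>Pythagoras. Orthogonality of \<open>xs\<close> to the left singular vectors means that
  centring at \<open>xs\<close> leaves the modes unshifted.\<close>

lemma lyapunov_eq_modes:
  assumes "\<And>b. b \<in> B \<Longrightarrow> xs \<bullet> left_vec b = 0"
  shows "lyapunov xs 0 s = residual_energy xs s + (\<Sum>b\<in>B. energy (mode b s))"
proof -
  obtain x xh y yh where s: "s = (x, xh, y, yh)" by (metis surj_pair)
  have "(norm (z - xs))\<^sup>2 = (norm (residual (z - xs)))\<^sup>2 + (\<Sum>b\<in>B. (z \<bullet> left_vec b)\<^sup>2)" for z
    by (subst norm_residual) (simp add: inner_diff_left assms)
  then show ?thesis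
    by (simp add: s norm_expand[of y] norm_expand[of yh] energy_def cmod_power2 sum.distrib)
qed

text \<open>The gradient term lies in the range of \<open>A\<close> and has no residual, so only the
  damping acts. The assumption makes the two centred residuals opposite; each step preserves this
  and multiplies both by \<open>1 - 2 * \<rho>\<close>.\<close>

lemma residual_energy_dgda:
  assumes "residual (x - xs) + residual (xh - xs) = 0"
  shows "residual_energy xs (dgda (bilinear_fun A) \<eta> \<rho> (x, xh, y, yh) k)
    = ((1 - 2 * \<rho>)\<^sup>2) ^ k * residual_energy xs (x, xh, y, yh)"
proof -
  interpret residual: linear residual by (rule linear_residual)
  define S where "S = (\<lambda>k. dgda (bilinear_fun A) \<eta> \<rho> (x, xh, y, yh) k)"
  have "residual (fst (S k) - xs) = (1 - 2 * \<rho>) ^ k *\<^sub>R residual (x - xs) \<and>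
        residual (fst (snd (S k)) - xs) = (1 - 2 * \<rho>) ^ k *\<^sub>R residual (xh - xs)"
  proof (induction k)
    case 0
    then show ?case by (simp add: S_def dgda_def)
  next
    case (Suc k)
    obtain u uh v vh where Sk: "S k = (u, uh, v, vh)" by (metis surj_pair)
    have SSk: "S (Suc k) = dgda_step (bilinear_fun A) \<eta> \<rho> (u, uh, v, vh)"
      using Sk by (simp add: S_def dgda_def)
    define p q where "p = residual (u - xs)" and "q = residual (uh - xs)"
    have IH: "p = (1 - 2 * \<rho>) ^ k *\<^sub>R residual (x - xs)" "q = (1 - 2 * \<rho>) ^ k *\<^sub>R residual (xh - xs)"
      using Suc by (simp_all add: Sk p_def q_def)
    then have "q = - p"
      using assms by (simp add: add_eq_0_iff)
    have "residual (u - \<eta> *\<^sub>R (A *v v) - \<rho> *\<^sub>R (u - uh) - xs) = p - \<rho> *\<^sub>R (p - q)"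
      by (simp add: residual.diff residual.scale residual_image p_def q_def)
    also have "\<dots> = (1 - 2 * \<rho>) *\<^sub>R p"
      by (simp only: \<open>q = - p\<close> scaleR_reflect)
    finally have 1: "residual (u - \<eta> *\<^sub>R (A *v v) - \<rho> *\<^sub>R (u - uh) - xs) = (1 - 2 * \<rho>) *\<^sub>R p" .
    have "residual (uh - \<rho> *\<^sub>R (uh - u) - xs) = q - \<rho> *\<^sub>R (q - p)"
      by (simp add: residual.diff residual.scale p_def q_def)
    also have "\<dots> = (1 - 2 * \<rho>) *\<^sub>R q"
      using scaleR_reflect[of q \<rho>] by (simp add: \<open>q = - p\<close>)
    finally show ?case
      using 1 unfolding SSk dgda_step_bilinear_fun by (simp add: IH)
  qed
  moreover obtain u uh v vh where "S k = (u, uh, v, vh)" by (metis surj_pair)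
  ultimately show ?thesis
    by (simp add: S_def[symmetric] power_mult_distrib distrib_left power_even_abs
        flip: power_mult) (simp add: mult.commute)
qed

text \<open>Collects the finitely many modes and the residual part under one rate and one constant.
  A mode with a Jordan block requires a strict gap.\<close>

lemma dgda_converges_linearly_modes:
  assumes \<rho>: "0 < \<rho>" "\<rho> < 1" and "0 \<le> \<eta>"
    and rate: "\<And>b. b \<in> B \<Longrightarrow> mode_rate (\<eta> * norm (A *v b)) \<rho> \<le> r"
    and small: "\<And>b. b \<in> B \<Longrightarrow> \<eta> * norm (A *v b) \<le> 2 * \<rho>"
    and degenerate: "\<And>b. b \<in> B \<Longrightarrow> \<eta> * norm (A *v b) = 2 * \<rho> \<Longrightarrow> mode_rate (2 * \<rho>) \<rho> < r"
    and r: "(1 - 2 * \<rho>)\<^sup>2 \<le> r" "r < 1"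
  shows "dgda_converges_linearly (bilinear_fun A) \<eta> \<rho> r"
proof -
  have r0: "0 \<le> r" using r zero_le_power2 order_trans by blast
  have "\<exists>\<beta>>0. \<forall>s k. energy ((mode_step (\<eta> * norm (A *v b)) \<rho> ^^ k) s) \<le> \<beta> * r ^ k * energy s"
    if b: "b \<in> B" for b
  proof (cases "\<eta> * norm (A *v b) = 2 * \<rho>")
    case True
    then show ?thesis using mode_decay_degenerate[OF \<rho> degenerate[OF b True]] by simp
  next
    case False
    then show ?thesis
      using mode_decay_nondegenerate[OF \<rho> _ _ rate[OF b]] small[OF b] assms(3) by simp
  qed
  then obtain \<gamma> where \<gamma>: "\<And>b. b \<in> B \<Longrightarrow> 0 < \<gamma> b" and
    decay: "\<And>b s k. b \<in> B \<Longrightarrow>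
      energy ((mode_step (\<eta> * norm (A *v b)) \<rho> ^^ k) s) \<le> \<gamma> b * r ^ k * energy s"
    by metis
  \<comment> \<open>The summand 1 serves the residual part, the sum dominates every single
    \<open>\<gamma> b\<close>.\<close>
  define \<beta> where "\<beta> = 1 + (\<Sum>b\<in>B. \<gamma> b)"
  have \<beta>: "1 \<le> \<beta>" using \<gamma> by (simp add: \<beta>_def sum_nonneg less_imp_le)
  have \<gamma>_le: "\<gamma> b \<le> \<beta>" if "b \<in> B" for b
    using member_le_sum[OF that, of \<gamma>] \<gamma> finite_B by (force simp: \<beta>_def less_imp_le)
  have "\<exists>xs ys. saddle_point (bilinear_fun A) xs ys \<and>
      (\<forall>k. lyapunov xs ys (dgda (bilinear_fun A) \<eta> \<rho> s0 k) \<le> \<beta> * r ^ k * lyapunov xs ys s0)" for s0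
  proof -
    obtain x xh y yh where s0: "s0 = (x, xh, y, yh)" by (metis surj_pair)
    interpret residual: linear residual by (rule linear_residual)
    \<comment> \<open>The residual of the mean of \<open>x\<close> and \<open>xh\<close>, which the
      iteration preserves; the limit is thus known from \<open>s0\<close>.\<close>
    define xs where "xs = residual ((1 / 2) *\<^sub>R (x + xh))"
    have orth: "xs \<bullet> left_vec b = 0" if "b \<in> B" for b
      using inner_residual[OF that] by (simp add: xs_def)
    have "residual xs = xs"
      by (simp add: xs_def residual_idem)
    moreover have "xs + xs = residual x + residual xh"
      by (simp add: xs_def residual.add residual.scale flip: scaleR_add_left)
    ultimately have centre: "residual (x - xs) + residual (xh - xs) = 0"
      by (simp add: residual.diff algebra_simps)
    have "lyapunov xs 0 (dgda (bilinear_fun A) \<eta> \<rho> s0 k) \<le> \<beta> * r ^ k * lyapunov xs 0 s0" for k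
    proof -
      have "residual_energy xs (dgda (bilinear_fun A) \<eta> \<rho> s0 k)
          = ((1 - 2 * \<rho>)\<^sup>2) ^ k * residual_energy xs s0"
        unfolding s0 by (rule residual_energy_dgda[OF centre])
      also have "\<dots> \<le> \<beta> * r ^ k * residual_energy xs s0"
      proof (rule mult_right_mono)
        have "((1 - 2 * \<rho>)\<^sup>2) ^ k \<le> 1 * r ^ k" using power_mono[OF r(1)] by simp
        also have "\<dots> \<le> \<beta> * r ^ k" using \<beta> r0 by (intro mult_right_mono) auto
        finally show "((1 - 2 * \<rho>)\<^sup>2) ^ k \<le> \<beta> * r ^ k" .
        show "0 \<le> residual_energy xs s0" by (simp add: s0)
      qed
      finally have 1: "residual_energy xs (dgda (bilinear_fun A) \<eta> \<rho> s0 k) \<le> \<dots>" .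
      have "energy (mode b (dgda (bilinear_fun A) \<eta> \<rho> s0 k)) \<le> \<beta> * r ^ k * energy (mode b s0)"
        if b: "b \<in> B" for b
      proof -
        have "energy (mode b (dgda (bilinear_fun A) \<eta> \<rho> s0 k)) \<le> \<gamma> b * r ^ k * energy (mode b s0)"
          using decay[OF b] by (simp add: mode_dgda[OF b])
        also have "\<dots> \<le> \<beta> * r ^ k * energy (mode b s0)"
          using \<gamma>_le[OF b] r0 by (intro mult_right_mono energy_nonneg) auto
        finally show ?thesis .
      qed
      then have "(\<Sum>b\<in>B. energy (mode b (dgda (bilinear_fun A) \<eta> \<rho> s0 k)))
          \<le> \<beta> * r ^ k * (\<Sum>b\<in>B. energy (mode b s0))"
        by (simp add: sum_distrib_left sum_mono)
      with 1 show ?thesis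
        by (simp add: lyapunov_eq_modes[OF orth] distrib_left)
    qed
    moreover have "saddle_point (bilinear_fun A) xs 0"
      by (rule saddle_point_bilinear_fun) (simp add: xs_def residual_left_null)
    ultimately show ?thesis by blast
  qed
  moreover have "0 < \<beta>" using \<beta> by simp
  ultimately show ?thesis
    unfolding dgda_converges_linearly_def using r0 r(2) by blast
qed

section \<open>Extreme singular values and the two explicit rates\<close>

text \<open>An eigenvector of the Gram matrix has a nonzero coordinate along some \<open>b\<close>;
  pairing with \<open>b\<close> identifies its eigenvalue with that of \<open>b\<close>.\<close>

lemma singular_values_eq: "singular_values A = (\<lambda>b. norm (A *v b)) ` B"
proof -
  have gram: "(transpose A ** A) *v v = (A *v v) v* A" for v
    by (simp flip: matrix_vector_mul_assoc)
  have "eigenvalue (transpose A ** A) c \<longleftrightarrow> (\<exists>b\<in>B. c = (norm (A *v b))\<^sup>2)" for c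
  proof
    assume "eigenvalue (transpose A ** A) c"
    then obtain v where v: "v \<noteq> 0" "(A *v v) v* A = c *\<^sub>R v"
      by (auto simp: eigenvalue_def gram)
    obtain b where b: "b \<in> B" "v \<bullet> b \<noteq> 0"
      using expand[of v] v(1) by (metis (no_types, lifting) scale_eq_0_iff sum.neutral)
    have "c * (v \<bullet> b) = (A *v v) \<bullet> (A *v b)"
      using v(2) by (metis dot_lmul_matrix inner_scaleR_left)
    also have "\<dots> = (norm (A *v b))\<^sup>2 * (v \<bullet> b)"
      using gram_eigen[OF b(1)] by (metis dot_lmul_matrix inner_commute inner_scaleR_left)
    finally show "\<exists>b\<in>B. c = (norm (A *v b))\<^sup>2" using b by auto
  next
    assume "\<exists>b\<in>B. c = (norm (A *v b))\<^sup>2"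
    then obtain b where b: "b \<in> B" "c = (norm (A *v b))\<^sup>2" by blast
    then have "b \<noteq> 0" using norm_B by force
    then show "eigenvalue (transpose A ** A) c"
      using gram_eigen b by (auto simp: eigenvalue_def gram)
  qed
  then show ?thesis
    by (force simp: singular_values_def)
qed

lemma nonempty_B: "B \<noteq> {}"
proof
  assume "B = {}"
  then have "(1 :: real^'m) = 0" using span_B by (metis UNIV_I singletonD span_empty)
  then show False by simp
qed

lemma sigma_bounds:
  assumes "b \<in> B"
  shows "sigma_min A \<le> norm (A *v b)" "norm (A *v b) \<le> sigma_max A"
  using assms finite_B by (auto simp: sigma_min_def sigma_max_def singular_values_eq)

lemma sigma_min_pos: "0 < sigma_min A"
proof -
  have "sigma_min A \<in> (\<lambda>b. norm (A *v b)) ` B"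
    unfolding sigma_min_def singular_values_eq using finite_B nonempty_B by (intro Min_in) auto
  then show ?thesis using nonzero by auto
qed

lemma sigma_min_le_max: "sigma_min A \<le> sigma_max A"
  using nonempty_B sigma_bounds order_trans by blast

text \<open>The mode of \<open>sigma_min A\<close> dictates the rate. As
  \<open>\<eta> * sigma_min A < 2 * \<rho>\<close>, this rate strictly exceeds that of a Jordan
  block, so modes with \<open>t = 2 * \<rho>\<close> are covered as well.\<close>

theorem dgda_converges_linearly_rate:
  assumes "0 < \<rho>" "0 < \<eta>" "\<eta> \<le> 2 * \<rho> / sigma_max A" "\<rho> < 1" "\<eta> * sigma_min A < 2 * \<rho>"
  shows "dgda_converges_linearly (bilinear_fun A) \<eta> \<rho> (dgda_rate A \<eta> \<rho>)"
proof -
  have rate: "dgda_rate A \<eta> \<rho> = mode_rate (\<eta> * sigma_min A) \<rho>"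
    by (simp add: dgda_rate_def mode_rate_def power_mult_distrib)
  have max: "\<eta> * sigma_max A \<le> 2 * \<rho>"
    using assms sigma_min_pos sigma_min_le_max by (simp add: field_simps)
  have lower: "mode_rate (2 * \<rho>) \<rho> < dgda_rate A \<eta> \<rho>"
    unfolding rate using assms sigma_min_pos by (intro mode_rate_strict_antimono) auto
  show ?thesis
  proof (rule dgda_converges_linearly_modes)
    fix b assume b: "b \<in> B"
    show "mode_rate (\<eta> * norm (A *v b)) \<rho> \<le> dgda_rate A \<eta> \<rho>"
      unfolding rate using assms sigma_min_pos sigma_bounds[OF b]
      by (intro mode_rate_antimono mult_left_mono) auto
    show "\<eta> * norm (A *v b) \<le> 2 * \<rho>"
      using mult_left_mono[OF sigma_bounds(2)[OF b] less_imp_le[OF assms(2)]] max by linarith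
  next
    have "\<rho> * \<rho> \<le> \<rho>" using assms by (simp add: mult_left_le)
    then have "(1 - 2 * \<rho>)\<^sup>2 \<le> mode_rate (2 * \<rho>) \<rho>"
      unfolding mode_rate_double by (simp add: power2_eq_square algebra_simps)
    then show "(1 - 2 * \<rho>)\<^sup>2 \<le> dgda_rate A \<eta> \<rho>" using lower by simp
    show "dgda_rate A \<eta> \<rho> < 1"
      \<comment> \<open>Comparison with \<open>t = 0\<close>, where the rate is 1.\<close>
      unfolding rate using mode_rate_strict_antimono[of \<rho> 0 "\<eta> * sigma_min A"] assms sigma_min_pos
      by (simp add: mode_rate_zero)
  qed (use assms lower in auto)
qed

theorem dgda_converges_linearly_kappa:
  "dgda_converges_linearly (bilinear_fun A) (1 / sigma_max A) (1 / 2) (1 - 1 / (4 * kappa A))"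
proof -
  define s where "s = sigma_min A / sigma_max A"
  have max: "0 < sigma_max A" using sigma_min_pos sigma_min_le_max by simp
  have s: "0 < s" "s \<le> 1" using max sigma_min_pos sigma_min_le_max by (auto simp: s_def)
  have s2: "s\<^sup>2 \<le> 1" using s by (simp add: power_le_one)
  have r: "1 - 1 / (4 * kappa A) = 1 - s\<^sup>2 / 4"
    by (simp add: kappa_def s_def power_divide)
  have "sqrt (1 - s\<^sup>2) \<le> 1 - s\<^sup>2 / 2"
  proof (rule real_le_lsqrt)
    show "1 - s\<^sup>2 \<le> (1 - s\<^sup>2 / 2)\<^sup>2" by (simp add: power2_diff power_divide)
  qed (use s2 in auto)
  then have rate: "mode_rate s (1 / 2) \<le> 1 - s\<^sup>2 / 4"
    by (simp add: mode_rate_def power_divide)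
  show ?thesis
    unfolding r
  proof (rule dgda_converges_linearly_modes)
    fix b assume b: "b \<in> B"
    have "s \<le> 1 / sigma_max A * norm (A *v b)"
      using sigma_bounds(1)[OF b] max by (simp add: s_def divide_right_mono)
    then have "mode_rate (1 / sigma_max A * norm (A *v b)) (1 / 2) \<le> mode_rate s (1 / 2)"
      using s by (intro mode_rate_antimono) auto
    with rate show "mode_rate (1 / sigma_max A * norm (A *v b)) (1 / 2) \<le> 1 - s\<^sup>2 / 4" by simp
    show "1 / sigma_max A * norm (A *v b) \<le> 2 * (1 / 2)"
      using sigma_bounds(2)[OF b] max by simp
    \<comment> \<open>The Jordan block has rate 1/2, while the right side is at least 3/4.\<close>
    show "mode_rate (2 * (1 / 2)) (1 / 2) < 1 - s\<^sup>2 / 4"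
      unfolding mode_rate_double using s2 by (simp add: power_divide)
  qed (use s s2 max in auto)
qed

end

text \<open>The Gram map is symmetric, hence has an orthonormal eigenbasis; pairing with
  \<open>b\<close> shows its eigenvalue to be the squared norm of \<open>A *v b\<close>. Full column
  rank is injectivity, so no singular value vanishes.\<close>

lemma full_rank_singular_system:
  fixes A :: "real^'m^'n"
  assumes "rank A = CARD('m)"
  shows "\<exists>B. singular_system A B"
proof -
  have inj: "A *v v \<noteq> 0" if "v \<noteq> 0" for v
    using assms that by (metis full_rank_injective injD matrix_vector_mult_0_right)
  let ?f = "\<lambda>v. (A *v v) v* A"
  have "linear ?f"
    by (rule linearI)
      (simp_all add: matrix_vector_right_distrib matrix_vector_mult_scaleR
        flip: transpose_matrix_vector)
  moreover have "?f x \<bullet> y = x \<bullet> ?f y" for x y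
    by (metis dot_lmul_matrix inner_commute)
  ultimately obtain B where B: "finite B" "span B = UNIV" "pairwise orthogonal B"
      "\<And>b. b \<in> B \<Longrightarrow> norm b = 1" "\<And>b. b \<in> B \<Longrightarrow> \<exists>c. ?f b = c *\<^sub>R b"
    by (rule symmetric_linear_orthonormal_eigenbasis) blast
  have "?f b = (norm (A *v b))\<^sup>2 *\<^sub>R b" if b: "b \<in> B" for b
  proof -
    obtain c where c: "?f b = c *\<^sub>R b" using B(5)[OF b] by blast
    have "(norm (A *v b))\<^sup>2 = ?f b \<bullet> b"
      by (simp add: dot_lmul_matrix power2_norm_eq_inner)
    also have "\<dots> = c" using B(4)[OF b] by (simp add: c norm_eq_1)
    finally show ?thesis using c by simp
  qed
  moreover have "A *v b \<noteq> 0" if "b \<in> B" for b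
    by (rule inj) (use B(4)[OF that] in auto)
  ultimately have "singular_system A B"
    using B(1-4) by (intro singular_system.intro)
  then show ?thesis ..
qed

theorem theorem2:
  fixes A :: "real^'m^'n"
  assumes "CARD('m) \<le> CARD('n)"
    and "rank A = min CARD('m) CARD('n)"
  shows "(\<forall>\<rho> \<eta>. 0 < \<rho> \<and> 0 < \<eta> \<and> \<eta> \<le> 2 * \<rho> / sigma_max A \<and>
              \<rho> < 1 \<and> \<eta> * sigma_min A < 2 * \<rho> \<longrightarrow>
            dgda_converges_linearly (bilinear_fun A) \<eta> \<rho> (dgda_rate A \<eta> \<rho>)) \<and>
         dgda_converges_linearly (bilinear_fun A) (1 / sigma_max A) (1/2) (1 - 1 / (4 * kappa A))"
proof -
  obtain B where "singular_system A B"
    \<comment> \<open>By the first assumption the minimum is \<open>CARD('m)\<close>, so the rank is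
      the full column rank.\<close>
    using full_rank_singular_system assms by force
  then interpret singular_system A B .
  show ?thesis
    using dgda_converges_linearly_rate dgda_converges_linearly_kappa by blast
qed

end
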